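(* Let $\rho>0$, $M_3>0$ and $p\in\mathbb{R}^2$. For every estimator $\mathcal{E}$, i.e. every map assigning to each complete noiseless circular observation $\mathcal{Y}_{\rho,p}(F)$ a vector in $\mathbb{R}^2$, $$\sup_{F\in\mathscr{F}_3(M_3)}\left\|\mathcal{E}\!\left(\mathcal{Y}_{\rho,p}(F)\right)-\nabla F(p)\right\|\ \geq\ \frac{M_3\rho^2}{6}.$$
   Context: Write $\varphi(\alpha)=[\cos\alpha\ \ \sin\alpha]^\top$. For a fixed scan center $p\in\mathbb{R}^2$ and sensing radius $\rho>0$, $\mathscr{F}_3(M_3)$ denotes the class of scalar fields $F:\mathbb{R}^2\to\mathbb{R}$ that are $C^3$ on a neighborhood of the closed disk of radius $\rho$ centered at $p$ and satisfy $\|D^3F\|\leq M_3$ there, where $\|D^3F(q)\|$ is the operator norm of the third derivative as a symmetric trilinear form. The complete noiseless circular observation of $F$ is the set $$\mathcal{Y}_{\rho,p}(F):=\{(\alpha,F(p+\rho\varphi(\alpha))):\alpha\in[0,2\pi)\}.$$ $\|\cdot\|$ on $\mathbb{R}^2$ is the Euclidean norm. No regularity of $\mathcal{E}$ is assumed. *)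

theory Defs
  imports "HOL-Analysis.Analysis"
begin

definition direction :: "real \<Rightarrow> real ^ 2" where
  "direction \<alpha> = vector [cos \<alpha>, sin \<alpha>]"

definition gradient :: "('a::real_inner \<Rightarrow> real) \<Rightarrow> 'a \<Rightarrow> 'a" where
  "gradient f x = (THE D. GDERIV f x :> D)"

(* Frechet derivative as a map into the normed space of bounded linear maps, so that it can be
   iterated; meaningful at points where f is differentiable. *)
definition fderiv ::
  "('a::real_normed_vector \<Rightarrow> 'b::real_normed_vector) \<Rightarrow> 'a \<Rightarrow> ('a \<Rightarrow>\<^sub>L 'b)" where
  "fderiv f x = Blinfun (frechet_derivative f (at x))"

(* The third derivative in curried form: third_deriv F q u v w is D^3 F(q)[u, v, w]. *)
definition third_deriv ::
  "('a::real_normed_vector \<Rightarrow> real) \<Rightarrow> 'a \<Rightarrow> ('a \<Rightarrow>\<^sub>L 'a \<Rightarrow>\<^sub>L 'a \<Rightarrow>\<^sub>L real)" where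
  "third_deriv F = fderiv (fderiv (fderiv F))"

(* For open U only. *)
definition C3_on :: "('a::real_normed_vector) set \<Rightarrow> ('a \<Rightarrow> real) \<Rightarrow> bool" where
  "C3_on U F \<longleftrightarrow>
     (\<forall>x\<in>U. F differentiable (at x)) \<and>
     (\<forall>x\<in>U. fderiv F differentiable (at x)) \<and>
     (\<forall>x\<in>U. fderiv (fderiv F) differentiable (at x)) \<and>
     continuous_on U (third_deriv F)"

(* The norm of a curried trilinear form, obtained by iterating the operator norm, is the operator
   norm of the trilinear form: the least M >= 0 with |T(u,v,w)| <= M |u| |v| |w|. *)
lemma norm_trilinear_le_iff:
  fixes T :: "'a::real_normed_vector \<Rightarrow>\<^sub>L 'a \<Rightarrow>\<^sub>L 'a \<Rightarrow>\<^sub>L real"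
  assumes "0 \<le> M"
  shows "norm T \<le> M \<longleftrightarrow> (\<forall>u v w. \<bar>T u v w\<bar> \<le> M * norm u * norm v * norm w)"
proof
  assume T: "norm T \<le> M"
  show "\<forall>u v w. \<bar>T u v w\<bar> \<le> M * norm u * norm v * norm w"
  proof (intro allI)
    fix u v w
    have "\<bar>T u v w\<bar> \<le> norm (T u v) * norm w"
      using norm_blinfun[of "T u v" w] by simp
    also have "\<dots> \<le> norm (T u) * norm v * norm w"
      by (intro mult_right_mono norm_blinfun norm_ge_zero)
    also have "\<dots> \<le> norm T * norm u * norm v * norm w"
      by (intro mult_right_mono norm_blinfun norm_ge_zero)
    also have "\<dots> \<le> M * norm u * norm v * norm w"
      by (intro mult_right_mono T norm_ge_zero)
    finally show "\<bar>T u v w\<bar> \<le> M * norm u * norm v * norm w" .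
  qed
next
  assume "\<forall>u v w. \<bar>T u v w\<bar> \<le> M * norm u * norm v * norm w"
  then show "norm T \<le> M"
    using assms by (intro norm_blinfun_bound) (auto simp: mult_ac)
qed

definition C3_fields :: "real ^ 2 \<Rightarrow> real \<Rightarrow> real \<Rightarrow> (real ^ 2 \<Rightarrow> real) set" where
  "C3_fields p \<rho> M =
     {F. \<exists>U. open U \<and> cball p \<rho> \<subseteq> U \<and> C3_on U F \<and> (\<forall>q\<in>U. norm (third_deriv F q) \<le> M)}"

definition observation ::
  "real \<Rightarrow> real ^ 2 \<Rightarrow> (real ^ 2 \<Rightarrow> real) \<Rightarrow> (real \<times> real) set" where
  "observation \<rho> p F = {(\<alpha>, F (p + \<rho> *\<^sub>R direction \<alpha>)) | \<alpha>. \<alpha> \<in> {0..<2 * pi}}"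

end

theory Submission
  imports Defs
begin

text \<open>
  The two cubics \<open>F\<^sub>\<plusminus>(p + z) = \<plusminus> (M\<^sub>3 / 6) (\<bar>z\<bar>\<^sup>2 - \<rho>\<^sup>2) (a \<bullet> z)\<close>, with \<open>a\<close> a unit vector, vanish on the
  observation circle, so no estimator can tell them apart, while their gradients at \<open>p\<close> are
  \<open>\<minusplus> (M\<^sub>3 \<rho>\<^sup>2 / 6) a\<close>. By the triangle inequality one of the two errors is at least \<open>M\<^sub>3 \<rho>\<^sup>2 / 6\<close>.
  The third derivative is the constant form
  \<open>(M\<^sub>3 / 3) ((u \<bullet> v) (a \<bullet> w) + (u \<bullet> w) (a \<bullet> v) + (v \<bullet> w) (a \<bullet> u))\<close>, whose norm is at most \<open>M\<^sub>3\<close> because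
  each summand is at most 1 on unit vectors.
\<close>

text \<open>\<open>Blinfun\<close> undoes \<open>blinfun_apply\<close>, so a derivative already
  given as a bounded linear map can be read off as the value of \<open>fderiv\<close>, ready to be
  differentiated again.\<close>

lemma fderiv_eqI:
  assumes "(f has_derivative blinfun_apply D) (at x)"
  shows "fderiv f x = D"
  unfolding fderiv_def frechet_derivative_at[OF assms, symmetric] by (rule blinfun_apply_inverse)

lemma gradient_eqI:
  assumes "GDERIV f x :> D"
  shows "gradient f x = D"
  unfolding gradient_def
proof (rule the_equality)
  fix D' assume "GDERIV f x :> D'"
  with assms have "(\<lambda>h. h \<bullet> D') = (\<lambda>h. h \<bullet> D)"
    unfolding gderiv_def by (rule has_derivative_unique[rotated])
  \<comment> \<open>At the argument \<open>D' - D\<close> the two sides differ by the squared norm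
    of \<open>D' - D\<close>.\<close>
  then have "(D' - D) \<bullet> D' = (D' - D) \<bullet> D"
    by (rule fun_cong)
  then show "D' = D"
    using inner_eq_zero_iff[of "D' - D"] by (simp add: inner_diff_right)
qed (fact assms)

context
  fixes T :: "'a::real_normed_vector \<Rightarrow>\<^sub>L 'a \<Rightarrow>\<^sub>L 'a \<Rightarrow>\<^sub>L real" and l :: "'a \<Rightarrow>\<^sub>L real" and p :: 'a
  assumes sym12: "\<And>u v. T u v = T v u" and sym23: "\<And>u v w. T u v w = T u w v"
begin

text \<open>A Taylor polynomial at \<open>p\<close>: the factor 1/6 = 1/3! makes \<open>T\<close>
  itself the third derivative at every point, and \<open>l\<close> is the first derivative at
  \<open>p\<close>.\<close>

definition cubic :: "'a \<Rightarrow> real" where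
  "cubic x = T (x - p) (x - p) (x - p) / 6 + l (x - p)"

lemma cubic_has_derivative:
  "(cubic has_derivative blinfun_apply ((1/2) *\<^sub>R T (x - p) (x - p) + l)) (at x)"
proof (rule has_derivative_eq_rhs)
  let ?z = "x - p"
  show "(cubic has_derivative (\<lambda>h. (T ?z ?z h + (T ?z h ?z + T h ?z ?z)) / 6 + l h)) (at x)"
    unfolding cubic_def [abs_def] divide_inverse
    by (rule derivative_eq_intros refl | simp add: blinfun.add_left)+
  \<comment> \<open>Symmetry merges the three product rule terms into 3 \<open>T ?z ?z h\<close>,
    and 3/6 leaves the factor 1/2.\<close>
  have "T ?z h ?z = T ?z ?z h" "T h ?z ?z = T ?z ?z h" for h
    using sym12 sym23 by metis+
  then show "(\<lambda>h. (T ?z ?z h + (T ?z h ?z + T h ?z ?z)) / 6 + l h) =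
      blinfun_apply ((1/2) *\<^sub>R T ?z ?z + l)"
    by (intro ext) (simp only: blinfun.add_left blinfun.scaleR_left real_scaleR_def, simp)
qed

lemma fderiv_cubic: "fderiv cubic = (\<lambda>x. (1/2) *\<^sub>R T (x - p) (x - p) + l)"
  by (intro ext fderiv_eqI cubic_has_derivative)

lemma fderiv_cubic_has_derivative:
  "(fderiv cubic has_derivative blinfun_apply (T (x - p))) (at x)"
proof (rule has_derivative_eq_rhs)
  let ?z = "x - p"
  show "(fderiv cubic has_derivative (\<lambda>h. (1/2) *\<^sub>R (T ?z h + T h ?z))) (at x)"
    unfolding fderiv_cubic by (rule derivative_eq_intros refl | simp)+
  show "(\<lambda>h. (1/2) *\<^sub>R (T ?z h + T h ?z)) = blinfun_apply (T ?z)"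
    unfolding sym12[of _ ?z] by (intro ext scaleR_half_double)
qed

lemma fderiv_fderiv_cubic: "fderiv (fderiv cubic) = (\<lambda>x. T (x - p))"
  by (intro ext fderiv_eqI fderiv_cubic_has_derivative)

lemma fderiv_fderiv_cubic_has_derivative:
  "(fderiv (fderiv cubic) has_derivative blinfun_apply T) (at x)"
  unfolding fderiv_fderiv_cubic by (rule derivative_eq_intros refl | simp)+

lemma third_deriv_cubic: "third_deriv cubic = (\<lambda>x. T)"
  unfolding third_deriv_def by (intro ext fderiv_eqI fderiv_fderiv_cubic_has_derivative)

lemma C3_on_cubic: "C3_on U cubic"
  unfolding C3_on_def third_deriv_cubic
  by (blast intro: differentiableI cubic_has_derivative fderiv_cubic_has_derivative
      fderiv_fderiv_cubic_has_derivative continuous_on_const)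

end

text \<open>Polarization of a cubic form: on the diagonal u = v = w = z the value is 3 |z|^2 (a
  \<bullet> z).\<close>

definition sym_inner3 :: "'a::euclidean_space \<Rightarrow> 'a \<Rightarrow>\<^sub>L 'a \<Rightarrow>\<^sub>L 'a \<Rightarrow>\<^sub>L real" where
  "sym_inner3 a = Blinfun (\<lambda>u. Blinfun (\<lambda>v. Blinfun (\<lambda>w.
     (u \<bullet> v) * (a \<bullet> w) + (u \<bullet> w) * (a \<bullet> v) + (v \<bullet> w) * (a \<bullet> u))))"

lemma sym_inner3_apply:
  "sym_inner3 a u v w = (u \<bullet> v) * (a \<bullet> w) + (u \<bullet> w) * (a \<bullet> v) + (v \<bullet> w) * (a \<bullet> u)"
proof -
  let ?t = "\<lambda>u v w. (u \<bullet> v) * (a \<bullet> w) + (u \<bullet> w) * (a \<bullet> v) + (v \<bullet> w) * (a \<bullet> u)"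
  \<comment> \<open>The nested \<open>Blinfun\<close> layers are unfolded from the innermost
    outwards; in finite dimension linearity of each layer already gives boundedness.\<close>
  have w: "blinfun_apply (Blinfun (?t u v)) = ?t u v" for u v
    by (intro bounded_linear_Blinfun_apply linear_conv_bounded_linear[THEN iffD1] linearI)
      (auto simp: algebra_simps)
  have v: "blinfun_apply (Blinfun (\<lambda>v. Blinfun (?t u v))) = (\<lambda>v. Blinfun (?t u v))" for u
    by (intro bounded_linear_Blinfun_apply linear_conv_bounded_linear[THEN iffD1] linearI blinfun_eqI;
      unfold w blinfun.add_left blinfun.scaleR_left; simp add: algebra_simps)
  have u: "blinfun_apply (Blinfun (\<lambda>u. Blinfun (\<lambda>v. Blinfun (?t u v)))) =
      (\<lambda>u. Blinfun (\<lambda>v. Blinfun (?t u v)))"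
    by (intro bounded_linear_Blinfun_apply linear_conv_bounded_linear[THEN iffD1] linearI blinfun_eqI;
      unfold w v blinfun.add_left blinfun.scaleR_left; simp add: algebra_simps)
  show ?thesis
    by (simp add: sym_inner3_def u v w)
qed

lemma norm_sym_inner3_le:
  assumes "norm a \<le> 1"
  shows "norm (sym_inner3 a) \<le> 3"
proof -
  have *: "\<bar>(u \<bullet> v) * (a \<bullet> w)\<bar> \<le> norm u * norm v * norm w" for u v w
  proof -
    have "\<bar>a \<bullet> w\<bar> \<le> norm w"
      using Cauchy_Schwarz_ineq2[of a w] mult_right_mono[OF assms, of "norm w"] by simp
    then show ?thesis
      by (simp add: abs_mult mult_mono Cauchy_Schwarz_ineq2)
  qed
  show ?thesis
    unfolding norm_trilinear_le_iff[OF zero_le_numeral] sym_inner3_apply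
  proof (intro allI)
    fix u v w
    show "\<bar>(u \<bullet> v) * (a \<bullet> w) + (u \<bullet> w) * (a \<bullet> v) + (v \<bullet> w) * (a \<bullet> u)\<bar>
        \<le> 3 * norm u * norm v * norm w"
      using *[of u v w] *[of u w v] *[of v w u] by (simp add: mult_ac)
  qed
qed

lemma norm_direction [simp]: "norm (direction \<alpha>) = 1"
  by (simp add: direction_def norm_eq_1 inner_vec_def sum_2 flip: power2_eq_square)

text \<open>The signed coefficient \<open>c\<close> covers both fields of the pair, c = M/6 and c =
  -M/6.\<close>

lemma exists_unobservable_field:
  fixes c :: real and a p :: "real ^ 2"
  assumes "norm a = 1" "\<bar>c\<bar> \<le> M / 6"
  shows "\<exists>F \<in> C3_fields p \<rho> M. (\<forall>\<alpha>. F (p + \<rho> *\<^sub>R direction \<alpha>) = 0) \<and>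
           gradient F p = (- c * \<rho>\<^sup>2) *\<^sub>R a"
proof -
  \<comment> \<open>With z = x - p, \<open>?T z z z / 6\<close> equals c |z|^2 (a \<bullet> z), and
    \<open>?l\<close> subtracts c \<rho>^2 (a \<bullet> z). The sum c (|z|^2 - \<rho>^2) (a
    \<bullet> z) vanishes on the circle.\<close>
  let ?T = "(2 * c) *\<^sub>R sym_inner3 a"
  let ?l = "blinfun_inner_left ((- c * \<rho>\<^sup>2) *\<^sub>R a)"
  have sym12: "?T u v = ?T v u" and sym23: "?T u v w = ?T u w v" for u v w
    by (auto intro!: blinfun_eqI simp: blinfun.bilinear_simps sym_inner3_apply inner_commute)
  let ?F = "cubic ?T ?l p"
  have "norm ?T \<le> M"
    using mult_mono[of "2 * \<bar>c\<bar>" "M / 3" "norm (sym_inner3 a)" 3] norm_sym_inner3_le[of a] assms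
    by (simp add: abs_mult)
  then have "?F \<in> C3_fields p \<rho> M"
    using C3_on_cubic[OF sym12 sym23] third_deriv_cubic[OF sym12 sym23]
    by (auto simp: C3_fields_def intro!: exI[of _ UNIV])
  moreover have "?F (p + \<rho> *\<^sub>R direction \<alpha>) = 0" for \<alpha>
    unfolding cubic_def[OF sym12 sym23]
    by (simp add: blinfun.bilinear_simps sym_inner3_apply dot_square_norm inner_commute
        power2_eq_square field_simps)
  \<comment> \<open>At \<open>p\<close> the term quadratic in x - p drops out, so only
    \<open>?l\<close> remains.\<close>
  moreover have "gradient ?F p = (- c * \<rho>\<^sup>2) *\<^sub>R a"
    using cubic_has_derivative[OF sym12 sym23, of ?l p p]
    by (intro gradient_eqI) (simp add: gderiv_def)
  ultimately show ?thesis by blast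
qed

theorem lemma1:
  fixes \<rho> M\<^sub>3 :: real and p :: "real ^ 2"
    and \<E> :: "(real \<times> real) set \<Rightarrow> real ^ 2"
  assumes "\<rho> > 0" and "M\<^sub>3 > 0"
  shows "(SUP F \<in> C3_fields p \<rho> M\<^sub>3.
            ereal (norm (\<E> (observation \<rho> p F) - gradient F p))) \<ge> ereal (M\<^sub>3 * \<rho>\<^sup>2 / 6)"
proof -
  define a :: "real ^ 2" where "a = axis 1 1"
  let ?r = "M\<^sub>3 * \<rho>\<^sup>2 / 6"
  have a: "norm a = 1" by (simp add: a_def)
  obtain F where F: "F \<in> C3_fields p \<rho> M\<^sub>3" "\<And>\<alpha>. F (p + \<rho> *\<^sub>R direction \<alpha>) = 0"
      "gradient F p = (- ?r) *\<^sub>R a"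
    using exists_unobservable_field[OF a, of "M\<^sub>3 / 6" M\<^sub>3 p \<rho>] assms by auto
  obtain G where G: "G \<in> C3_fields p \<rho> M\<^sub>3" "\<And>\<alpha>. G (p + \<rho> *\<^sub>R direction \<alpha>) = 0"
      "gradient G p = ?r *\<^sub>R a"
    using exists_unobservable_field[OF a, of "- M\<^sub>3 / 6" M\<^sub>3 p \<rho>] assms by auto
  define e where "e = \<E> (observation \<rho> p F)"
  have e: "\<E> (observation \<rho> p G) = e"
    using F(2) G(2) by (simp add: e_def observation_def)
  \<comment> \<open>The gradients at \<open>p\<close> are \<open>- ?r\<close> and \<open>?r\<close>
    times a unit vector, so the error vectors of the common estimate \<open>e\<close> lie 2
    \<open>?r\<close> apart.\<close>
  have "2 * ?r = norm ((e + ?r *\<^sub>R a) - (e - ?r *\<^sub>R a))"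
    using a assms by (simp flip: scaleR_add_left)
  also have "\<dots> \<le> norm (e + ?r *\<^sub>R a) + norm (e - ?r *\<^sub>R a)"
    by (rule norm_triangle_ineq4)
  finally consider "?r \<le> norm (e - gradient F p)" | "?r \<le> norm (e - gradient G p)"
    using F(3) G(3) by fastforce
  then show ?thesis
  proof cases
    case 1
    then show ?thesis
      using F(1) by (intro SUP_upper2[of F]) (auto simp: e_def)
  next
    case 2
    then show ?thesis
      using G(1) e by (intro SUP_upper2[of G]) auto
  qed
qed

end
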